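(* Let $R$ and $S$ be two non-collapsing iTRSs over disjoint signatures, both with term metric $\infty$, and both strongly converging. Then their disjoint union $R+S$ (again with term metric $\infty$) is strongly converging.
   Context: A signature is a set of function symbols of finite arity. The term metric $\infty$ assigns to every $n$-ary symbol the map $(x_1,\dots,x_n)\mapsto \tfrac12\max(x_1,\dots,x_n)$; the induced distance $d_\infty$ on finite terms is $d_\infty(t,t)=0$, $d_\infty(t,u)=1$ for different root symbols, $d_\infty(F(\vec t),F(\vec u))=\tfrac12\max_i d_\infty(t_i,u_i)$, and $\mathrm{Ter}_\infty$ is its metric completion (the finite and infinite terms). An iTRS consists of a signature, a term metric, and a set $R\subseteq\mathrm{Ter}_\infty\times\mathrm{Ter}_\infty$ of rules $l\to r$ with $l$ not a variable and variables of $r$ occurring in $l$; a rewrite step contracts an instance $\theta(l)$ of a left-hand side at some position $p$ (the redex position) of a term, replacing it by $\theta(r)$. It is non-collapsing if no right-hand side is a variable. A reduction sequence is a continuous map $f:\alpha\to\mathrm{Ter}_\infty$ ($\alpha$ an ordinal with the order topology) with $f(\beta)\to f(\beta+1)$ for $\beta+1<\alpha$; it is open if $\alpha$ is a limit ordinal. The iTRS is strongly converging if for every open reduction sequence of length $\alpha$ (with each step equipped with its redex position) and every position $p$, there is $\beta<\alpha$ such that no step $f(\gamma)\to f(\gamma+1)$ with $\beta\le\gamma$ contracts a redex at position $p$. The disjoint union of two iTRSs with disjoint signatures has the union of the signatures, the union of the rule sets, and term metric $\infty$. *)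

theory Defs
  imports "HOL-Analysis.Analysis"
begin

section \<open>Finite and infinite terms\<close>

codatatype (funs: 'f, vars: 'v) iterm =
    is_Var: Var 'v
  | Fun 'f (args: "('f, 'v) iterm list")

text \<open>A signature is a partial map: its domain is the set of function symbols and its values are
  their arities.\<close>

type_synonym 'f signature = "'f \<rightharpoonup> nat"

coinductive_set Ter :: "'f signature \<Rightarrow> ('f, 'v) iterm set" for \<Sigma> :: "'f signature" where
  Ter_Var: "Var x \<in> Ter \<Sigma>"
| Ter_Fun: "\<Sigma> f = Some (length ts) \<Longrightarrow> (\<And>t. t \<in> set ts \<Longrightarrow> t \<in> Ter \<Sigma>) \<Longrightarrow> Fun f ts \<in> Ter \<Sigma>"

lemma Fun_in_Ter: "Fun f ts \<in> Ter \<Sigma> \<longleftrightarrow> \<Sigma> f = Some (length ts) \<and> set ts \<subseteq> Ter \<Sigma>"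
  by (subst Ter.simps) auto

inductive_set FTer :: "'f signature \<Rightarrow> ('f, 'v) iterm set" for \<Sigma> :: "'f signature" where
  FTer_Var: "Var x \<in> FTer \<Sigma>"
| FTer_Fun: "\<Sigma> f = Some (length ts) \<Longrightarrow> (\<And>t. t \<in> set ts \<Longrightarrow> t \<in> FTer \<Sigma>) \<Longrightarrow> Fun f ts \<in> FTer \<Sigma>"


section \<open>The distance induced by the term metric \<open>\<infinity>\<close>\<close>

fun agree :: "nat \<Rightarrow> ('f, 'v) iterm \<Rightarrow> ('f, 'v) iterm \<Rightarrow> bool" where
  "agree 0 t u \<longleftrightarrow> True"
| "agree (Suc n) t u \<longleftrightarrow>
     (case (t, u) of
        (Var x, Var y) \<Rightarrow> x = y
      | (Fun f ts, Fun g us) \<Rightarrow> f = g \<and> list_all2 (agree n) ts us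
      | _ \<Rightarrow> False)"

lemma agree_refl [simp]: "agree n t t"
  by (induction n arbitrary: t) (auto split: iterm.split intro: list.rel_refl)

lemma agree_sym: "agree n t u \<Longrightarrow> agree n u t"
proof (induction n arbitrary: t u)
  case (Suc n)
  then show ?case
    by (cases t; cases u) (simp_all add: list_all2_conv_all_nth)
qed simp

lemma agree_trans: "agree n t u \<Longrightarrow> agree n u v \<Longrightarrow> agree n t v"
proof (induction n arbitrary: t u v)
  case (Suc n)
  show ?case
  proof (cases u)
    case (Var x)
    then show ?thesis using Suc.prems by (cases t; cases v) simp_all
  next
    case (Fun f us)
    obtain ts where t: "t = Fun f ts" "list_all2 (agree n) ts us"
      using Suc.prems(1) Fun by (cases t) auto
    obtain vs where v: "v = Fun f vs" "list_all2 (agree n) us vs"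
      using Suc.prems(2) Fun by (cases v) auto
    show ?thesis using t v Suc.IH by (auto elim: list_all2_trans[rotated])
  qed
qed simp

lemma agree_SucD: "agree (Suc n) t u \<Longrightarrow> agree n t u"
proof (induction n arbitrary: t u)
  case (Suc n)
  from Suc.prems have "list_all2 (agree n) (args t) (args u)" if "\<not> is_Var t" "\<not> is_Var u"
    using that Suc.IH
    by (cases t; cases u) (auto simp: list_all2_conv_all_nth simp del: agree.simps(2)
        simp: agree.simps(2)[of "Suc n"])
  with Suc.prems show ?case by (cases t; cases u) simp_all
qed simp

lemma agree_mono: "agree n t u \<Longrightarrow> m \<le> n \<Longrightarrow> agree m t u"
  by (induction n) (auto simp: le_Suc_eq simp del: agree.simps dest: agree_SucD)

lemma agree_all_eq: "(\<And>n. agree n t u) \<Longrightarrow> t = u"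
proof (coinduction arbitrary: t u rule: iterm.coinduct_strong)
  case Eq_iterm
  have S: "agree (Suc n) t u" for n using Eq_iterm by blast
  show ?case
  proof (cases t)
    case (Var x)
    then show ?thesis using S[of 0] by (auto split: iterm.splits)
  next
    case (Fun f ts)
    with S[of 0] obtain us where u: "u = Fun f us" by (auto split: iterm.splits)
    have "list_all2 (agree n) ts us" for n using S[of n] Fun u by simp
    then show ?thesis using Fun u by (auto simp: list_all2_conv_all_nth)
  qed
qed

text \<open>The distance of two different terms is \<open>2 ^ (- n)\<close> where \<open>n\<close> is the least depth at which
  they differ; \<open>dist_root\<close>, \<open>dist_Fun\<close>, \<open>Ter_complete\<close> and \<open>closure_FTer\<close> below confirm that this
  is \<open>d\<^sub>\<infinity>\<close> on finite terms, extended to their metric completion.\<close>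

instantiation iterm :: (type, type) metric_space
begin

definition dist_iterm :: "('a, 'b) iterm \<Rightarrow> ('a, 'b) iterm \<Rightarrow> real" where
  "dist_iterm t u = (if t = u then 0 else (1/2) ^ (LEAST n. \<not> agree (Suc n) t u))"

definition uniformity_iterm :: "(('a, 'b) iterm \<times> ('a, 'b) iterm) filter" where
  "uniformity_iterm = (INF e\<in>{0<..}. principal {(t, u). dist t u < e})"

definition open_iterm :: "('a, 'b) iterm set \<Rightarrow> bool" where
  "open_iterm U \<longleftrightarrow> (\<forall>t\<in>U. eventually (\<lambda>(t', u). t' = t \<longrightarrow> u \<in> U) uniformity)"

lemma dist_iterm_le_iff: "dist t u \<le> (1/2) ^ n \<longleftrightarrow> agree n t (u :: ('a, 'b) iterm)"
proof (cases "t = u")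
  case False
  then obtain m where m: "\<not> agree m t u" using agree_all_eq by blast
  then obtain k where "\<not> agree (Suc k) t u" by (cases m) auto
  define l where "l = (LEAST n. \<not> agree (Suc n) t u)"
  have l: "\<not> agree (Suc l) t u"
    unfolding l_def by (rule LeastI) fact
  have l': "agree l t u"
  proof (cases l)
    case (Suc j)
    then have "j < (LEAST n. \<not> agree (Suc n) t u)" unfolding l_def by simp
    from not_less_Least[OF this] show ?thesis unfolding Suc by (simp only: not_not)
  qed simp
  have "agree n t u \<longleftrightarrow> n \<le> l"
  proof
    show "n \<le> l" if "agree n t u"
      using l agree_mono[OF that, of "Suc l"] by (meson not_less_eq_eq)
    show "agree n t u" if "n \<le> l" using agree_mono[OF l' that] .
  qed
  moreover have "dist t u = (1/2) ^ l" using False by (simp add: dist_iterm_def l_def)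
  ultimately show ?thesis by (simp add: power_decreasing_iff)
qed (simp add: dist_iterm_def)

lemma dist_iterm_cases: "dist t (u :: ('a, 'b) iterm) = 0 \<or> (\<exists>n. dist t u = (1/2) ^ n)"
  by (auto simp: dist_iterm_def)

instance
proof
  fix t u v :: "('a, 'b) iterm"
  show "dist t u = 0 \<longleftrightarrow> t = u" by (simp add: dist_iterm_def)
  have sym: "dist a b = dist b a" for a b :: "('a, 'b) iterm"
  proof -
    have "(\<lambda>n. \<not> agree (Suc n) a b) = (\<lambda>n. \<not> agree (Suc n) b a)"
      using agree_sym by (intro ext) blast
    then show ?thesis unfolding dist_iterm_def by (simp only: eq_commute[of a b])
  qed
  have nn: "0 \<le> dist a b" for a b :: "('a, 'b) iterm" by (simp add: dist_iterm_def)
  have "dist t u \<le> max (dist t v) (dist u v)"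
  proof (cases "max (dist t v) (dist u v) = 0")
    case True
    then have "dist t v = 0" "dist u v = 0" using nn[of t v] nn[of u v] by auto
    then show ?thesis by (simp add: dist_iterm_def split: if_splits)
  next
    case False
    then obtain n where n: "max (dist t v) (dist u v) = (1/2) ^ n"
      using dist_iterm_cases[of t v] dist_iterm_cases[of u v] by (auto simp: max_def split: if_splits)
    then have "dist t v \<le> (1/2) ^ n" "dist u v \<le> (1/2) ^ n" by (metis max.cobounded1 max.cobounded2)+
    then have "agree n t u" unfolding dist_iterm_le_iff using agree_sym agree_trans by blast
    then show ?thesis unfolding n dist_iterm_le_iff .
  qed
  then show "dist t u \<le> dist t v + dist u v" using nn[of t v] nn[of u v] by linarith
qed (simp_all add: uniformity_iterm_def open_iterm_def)

end

lemma dist_root: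
  "dist (Var x) (Var y) = (if x = y then 0 else 1)"
  "dist (Var x) (Fun f ts) = 1"
  "dist (Fun f ts) (Var x) = 1"
  "f \<noteq> g \<Longrightarrow> dist (Fun f ts) (Fun g us) = 1"
  by (simp_all add: dist_iterm_def Least_eq_0)

lemma real_eqI_pow:
  fixes a b :: real
  assumes "a = 0 \<or> (\<exists>n. a = (1/2) ^ n)" "b = 0 \<or> (\<exists>n. b = (1/2) ^ n)"
    and "\<And>n. a \<le> (1/2) ^ n \<longleftrightarrow> b \<le> (1/2) ^ n"
  shows "a = b"
proof -
  have z: "c = 0" if "c = 0 \<or> (\<exists>n. c = (1/2) ^ n)" "\<And>n. c \<le> (1/2) ^ n" for c :: real
  proof (rule ccontr)
    assume "c \<noteq> 0"
    with that(1) obtain n where "c = (1/2) ^ n" by blast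
    with that(2)[of "Suc n"] show False by simp
  qed
  show ?thesis
  proof (cases "a = 0 \<or> b = 0")
    case True
    then have "\<forall>n. a \<le> (1/2) ^ n" using assms(3) by (metis zero_le_power zero_le_divide_1_iff zero_le_numeral)
    then have "a = 0" "b = 0" using z assms by blast+
    then show ?thesis by simp
  next
    case False
    then obtain n m where "a = (1/2) ^ n" "b = (1/2) ^ m" using assms(1,2) by blast
    then show ?thesis using assms(3)[of n] assms(3)[of m] by (metis order.refl antisym)
  qed
qed

lemma dist_Fun:
  assumes "length ts = length us"
  shows "dist (Fun f ts) (Fun f us) = 1/2 * Max (insert 0 {dist (ts ! i) (us ! i) |i. i < length ts})"
    (is "_ = 1/2 * Max ?D")
proof (rule real_eqI_pow)
  have fin: "finite ?D" by simp
  then have in_D: "Max ?D \<in> ?D" by (intro Max_in) auto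
  show "dist (Fun f ts) (Fun f us) = 0 \<or> (\<exists>n. dist (Fun f ts) (Fun f us) = (1/2) ^ n)"
    by (rule dist_iterm_cases)
  from in_D consider "Max ?D = 0" | i where "Max ?D = dist (ts ! i) (us ! i)" by blast
  then have "Max ?D = 0 \<or> (\<exists>n. Max ?D = (1/2) ^ n)"
    by cases (simp_all only: dist_iterm_cases, simp)
  then show "1/2 * Max ?D = 0 \<or> (\<exists>n. 1/2 * Max ?D = (1/2) ^ n)"
  proof (elim disjE exE)
    fix n assume "Max ?D = (1/2) ^ n"
    then have "1/2 * Max ?D = (1/2) ^ Suc n" by simp
    then show ?thesis by blast
  qed simp
  fix n
  show "dist (Fun f ts) (Fun f us) \<le> (1/2) ^ n \<longleftrightarrow> 1/2 * Max ?D \<le> (1/2) ^ n"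
  proof (cases n)
    case 0
    have "d \<le> 1" if "d \<in> ?D" for d
      using that dist_iterm_le_iff[of _ _ 0] by auto
    then have "Max ?D \<le> 1" using in_D by blast
    then show ?thesis using 0 dist_iterm_le_iff[of _ _ 0] by auto
  next
    case (Suc m)
    have "1/2 * Max ?D \<le> (1/2) ^ n \<longleftrightarrow> Max ?D \<le> (1/2) ^ m" using Suc by simp
    also have "\<dots> \<longleftrightarrow> (\<forall>i < length ts. dist (ts ! i) (us ! i) \<le> (1/2) ^ m)"
      using fin by (subst Max_le_iff) auto
    also have "\<dots> \<longleftrightarrow> list_all2 (agree m) ts us"
      using assms by (auto simp: list_all2_conv_all_nth dist_iterm_le_iff)
    finally show ?thesis unfolding dist_iterm_le_iff Suc by simp
  qed
qed

lemma agree_Ter: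
  assumes "\<And>n. \<exists>u \<in> Ter \<Sigma>. agree n t u"
  shows "t \<in> Ter \<Sigma>"
  using assms
proof (coinduction arbitrary: t)
  case Ter
  show ?case
  proof (cases t)
    case (Fun f ts)
    have *: "\<exists>us. Fun f us \<in> Ter \<Sigma> \<and> list_all2 (agree n) ts us" for n
    proof -
      from Ter obtain u where "u \<in> Ter \<Sigma>" "agree (Suc n) t u" by blast
      then show ?thesis using Fun by (auto split: iterm.splits)
    qed
    from *[of 0] have "\<Sigma> f = Some (length ts)"
      by (auto simp: Fun_in_Ter dest: list_all2_lengthD)
    moreover have "\<exists>u \<in> Ter \<Sigma>. agree n s u" if "s \<in> set ts" for s n
    proof -
      from *[of n] obtain us where us: "Fun f us \<in> Ter \<Sigma>" "list_all2 (agree n) ts us" by blast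
      from that obtain i where i: "i < length ts" "s = ts ! i" by (auto simp: in_set_conv_nth)
      with us have "us ! i \<in> Ter \<Sigma>" "agree n s (us ! i)"
        by (auto simp: Fun_in_Ter list_all2_conv_all_nth)
      then show ?thesis by blast
    qed
    ultimately show ?thesis using Fun by auto
  qed simp
qed

primcorec limit_term :: "(nat \<Rightarrow> ('f, 'v) iterm) \<Rightarrow> ('f, 'v) iterm" where
  "limit_term X = (case X 1 of
       Var x \<Rightarrow> Var x
     | Fun f ts \<Rightarrow> Fun f (map (\<lambda>i. limit_term (\<lambda>n. args (X (Suc n)) ! i)) [0..<length ts]))"

lemma agree_limit_term:
  assumes "\<And>n m. n \<le> m \<Longrightarrow> agree n (X n) (X m)"
  shows "agree n (X n) (limit_term X)"
  using assms
proof (induction n arbitrary: X)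
  case (Suc n)
  show ?case
  proof (cases "X 1")
    case (Var x)
    then show ?thesis using Suc.prems[of 1 "Suc n"]
      by (subst limit_term.code) (auto split: iterm.splits)
  next
    case (Fun f ts)
    have *: "\<exists>us. X (Suc m) = Fun f us \<and> length us = length ts" for m
      using Suc.prems[of 1 "Suc m"] Fun by (auto split: iterm.splits dest: list_all2_lengthD)
    let ?Y = "\<lambda>i n. args (X (Suc n)) ! i"
    have "agree n (?Y i n) (limit_term (?Y i))" if i: "i < length ts" for i
    proof (rule Suc.IH)
      fix k m :: nat assume "k \<le> m"
      then have "agree (Suc k) (X (Suc k)) (X (Suc m))" by (intro Suc.prems) simp
      then show "agree k (?Y i k) (?Y i m)"
        using *[of k] *[of m] i by (auto simp: list_all2_conv_all_nth)
    qed
    then show ?thesis using *[of n] Fun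
      by (subst limit_term.code) (auto simp: list_all2_conv_all_nth)
  qed
qed simp

lemma pow_half_less: "0 < e \<Longrightarrow> \<exists>n. (1/2) ^ n < (e :: real)"
  by (rule real_arch_pow_inv) auto

theorem Ter_complete: "complete (Ter \<Sigma> :: ('f, 'v) iterm set)"
  unfolding complete_def
proof (intro allI impI, elim conjE)
  fix X :: "nat \<Rightarrow> ('f, 'v) iterm"
  assume X: "\<forall>n. X n \<in> Ter \<Sigma>" and "Cauchy X"
  then have "\<exists>N. \<forall>k\<ge>N. \<forall>l\<ge>N. dist (X k) (X l) < (1/2) ^ n" for n
    by (auto simp: Cauchy_def)
  then have "\<exists>N. \<forall>k\<ge>N. \<forall>l\<ge>N. agree n (X k) (X l)" for n
    unfolding dist_iterm_le_iff[symmetric] by (meson less_imp_le)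
  then obtain N where N: "\<And>n k l. N n \<le> k \<Longrightarrow> N n \<le> l \<Longrightarrow> agree n (X k) (X l)" by metis
  define M where "M n = (MAX i\<in>{..n}. N i)" for n
  have NM: "N n \<le> M m" if "n \<le> m" for n m unfolding M_def using that by (intro Max_ge) auto
  define t where "t = limit_term (\<lambda>n. X (M n))"
  have t: "agree n (X (M n)) t" for n
    unfolding t_def by (rule agree_limit_term[of "\<lambda>n. X (M n)"]) (auto intro!: N NM)
  have t': "agree n (X k) t" if "M n \<le> k" for n k
    using t N[of n k "M n"] NM[of n n] that agree_trans by (meson order.trans order.refl)
  have "t \<in> Ter \<Sigma>" using t X by (intro agree_Ter) (meson agree_sym)
  moreover have "X \<longlonglongrightarrow> t"
  proof (rule metric_LIMSEQ_I)
    fix e :: real assume "0 < e"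
    then obtain n where "(1/2) ^ n < e" using pow_half_less by blast
    then show "\<exists>no. \<forall>k\<ge>no. dist (X k) t < e"
      using t'[of n] unfolding dist_iterm_le_iff[symmetric] by (meson le_less_trans)
  qed
  ultimately show "\<exists>l\<in>Ter \<Sigma>. X \<longlonglongrightarrow> l" by blast
qed

lemma FTer_approx: "t \<in> Ter \<Sigma> \<Longrightarrow> \<exists>u \<in> FTer \<Sigma>. agree n t u"
proof (induction n arbitrary: t)
  case 0
  show ?case by (rule bexI[OF _ FTer_Var]) simp
next
  case (Suc n)
  from Suc.prems show ?case
  proof cases
    case (Ter_Var x)
    then show ?thesis by (intro bexI[of _ t]) (simp_all add: FTer_Var del: agree.simps)
  next
    case (Ter_Fun f ts)
    then have "\<forall>s\<in>set ts. \<exists>u \<in> FTer \<Sigma>. agree n s u" using Suc.IH by blast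
    then obtain h where h: "\<And>s. s \<in> set ts \<Longrightarrow> h s \<in> FTer \<Sigma> \<and> agree n s (h s)" by metis
    have "Fun f (map h ts) \<in> FTer \<Sigma>" using h Ter_Fun by (intro FTer_Fun) auto
    moreover have "agree (Suc n) t (Fun f (map h ts))"
      using h Ter_Fun by (auto simp: list_all2_conv_all_nth)
    ultimately show ?thesis by blast
  qed
qed

theorem closure_FTer: "closure (FTer \<Sigma>) = (Ter \<Sigma> :: ('f, 'v) iterm set)"
proof (rule antisym)
  have "FTer \<Sigma> \<subseteq> (Ter \<Sigma> :: ('f, 'v) iterm set)"
  proof
    fix t :: "('f, 'v) iterm" assume "t \<in> FTer \<Sigma>"
    then show "t \<in> Ter \<Sigma>" by induction (auto intro: Ter.intros)
  qed
  then show "closure (FTer \<Sigma>) \<subseteq> (Ter \<Sigma> :: ('f, 'v) iterm set)"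
    by (intro closure_minimal complete_imp_closed Ter_complete)
  show "(Ter \<Sigma> :: ('f, 'v) iterm set) \<subseteq> closure (FTer \<Sigma>)"
  proof
    fix t :: "('f, 'v) iterm" assume t: "t \<in> Ter \<Sigma>"
    show "t \<in> closure (FTer \<Sigma>)"
      unfolding closure_approachable
    proof (intro allI impI)
      fix e :: real assume "0 < e"
      then obtain n where n: "(1/2) ^ n < e" using pow_half_less by blast
      obtain u where "u \<in> FTer \<Sigma>" "agree n t u" using FTer_approx t by blast
      then show "\<exists>u\<in>FTer \<Sigma>. dist u t < e"
        using n unfolding dist_iterm_le_iff[symmetric] by (metis dist_commute le_less_trans)
    qed
  qed
qed


section \<open>Infinitary term rewriting systems\<close>

primcorec subst :: "('v \<Rightarrow> ('f, 'v) iterm) \<Rightarrow> ('f, 'v) iterm \<Rightarrow> ('f, 'v) iterm" where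
  "subst \<theta> t = (case t of Var x \<Rightarrow> \<theta> x | Fun f ts \<Rightarrow> Fun f (map (subst \<theta>) ts))"

type_synonym pos = "nat list"

primrec is_pos :: "pos \<Rightarrow> ('f, 'v) iterm \<Rightarrow> bool" where
  "is_pos [] t = True"
| "is_pos (i # p) t = (case t of Var x \<Rightarrow> False | Fun f ts \<Rightarrow> i < length ts \<and> is_pos p (ts ! i))"

primrec subterm_at :: "pos \<Rightarrow> ('f, 'v) iterm \<Rightarrow> ('f, 'v) iterm" where
  "subterm_at [] t = t"
| "subterm_at (i # p) t = subterm_at p (args t ! i)"

primrec replace_at :: "pos \<Rightarrow> ('f, 'v) iterm \<Rightarrow> ('f, 'v) iterm \<Rightarrow> ('f, 'v) iterm" where
  "replace_at [] s t = s"
| "replace_at (i # p) s t =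
     (case t of Var x \<Rightarrow> Var x | Fun f ts \<Rightarrow> Fun f (ts[i := replace_at p s (ts ! i)]))"

text \<open>The term metric is \<open>\<infinity>\<close> throughout, so it is not a component of the record.\<close>

record ('f, 'v) itrs =
  sig :: "'f signature"
  rules :: "(('f, 'v) iterm \<times> ('f, 'v) iterm) set"

definition wf_itrs :: "('f, 'v) itrs \<Rightarrow> bool" where
  "wf_itrs R \<longleftrightarrow> rules R \<subseteq> Ter (sig R) \<times> Ter (sig R) \<and>
     (\<forall>(l, r) \<in> rules R. \<not> is_Var l \<and> vars r \<subseteq> vars l)"

definition non_collapsing :: "('f, 'v) itrs \<Rightarrow> bool" where
  "non_collapsing R \<longleftrightarrow> (\<forall>(l, r) \<in> rules R. \<not> is_Var r)"

definition rewrite_step ::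
    "('f, 'v) itrs \<Rightarrow> pos \<Rightarrow> ('f, 'v) iterm \<Rightarrow> ('f, 'v) iterm \<Rightarrow> bool" where
  "rewrite_step R p t u \<longleftrightarrow>
     (\<exists>l r \<theta>. (l, r) \<in> rules R \<and> range \<theta> \<subseteq> Ter (sig R) \<and> is_pos p t \<and>
        subterm_at p t = subst \<theta> l \<and> u = replace_at p (subst \<theta> r) t)"

definition disjoint_union :: "('f, 'v) itrs \<Rightarrow> ('f, 'v) itrs \<Rightarrow> ('f, 'v) itrs" where
  "disjoint_union R S = \<lparr>sig = sig R ++ sig S, rules = rules R \<union> rules S\<rparr>"


section \<open>Transfinite reduction sequences\<close>

text \<open>HOL has no type of all ordinals. Ordinals are elements of a well-ordered type, the ordinal
  \<open>\<alpha>\<close> being identified with its set of predecessors \<open>{..<\<alpha>}\<close>; the class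
  \<^class>\<open>linorder_topology\<close> says that the type carries its order topology, which on the
  initial segment \<open>{..<\<alpha>}\<close> induces the order topology of \<open>\<alpha>\<close>. The function \<open>ord_succ\<close> is only
  meaningful on non-maximal elements.\<close>

definition ord_succ :: "'o::wellorder \<Rightarrow> 'o" where
  "ord_succ \<beta> = (LEAST \<gamma>. \<beta> < \<gamma>)"

definition limit_ordinal :: "'o::wellorder \<Rightarrow> bool" where
  "limit_ordinal \<alpha> \<longleftrightarrow> (\<exists>\<beta>. \<beta> < \<alpha>) \<and> (\<forall>\<beta><\<alpha>. ord_succ \<beta> < \<alpha>)"

text \<open>The step from \<open>f \<beta>\<close> contracts a redex at position \<open>ps \<beta>\<close>.\<close>

definition reduction_sequence ::
    "('f, 'v) itrs \<Rightarrow> 'o::{wellorder, linorder_topology} \<Rightarrow> ('o \<Rightarrow> ('f, 'v) iterm) \<Rightarrow> ('o \<Rightarrow> pos) \<Rightarrow> bool"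
  where
  "reduction_sequence R \<alpha> f ps \<longleftrightarrow>
     f ` {..<\<alpha>} \<subseteq> Ter (sig R) \<and> continuous_on {..<\<alpha>} f \<and>
     (\<forall>\<beta><\<alpha>. ord_succ \<beta> < \<alpha> \<longrightarrow> rewrite_step R (ps \<beta>) (f \<beta>) (f (ord_succ \<beta>)))"

text \<open>The type argument supplies the ordinals over which lengths of reduction sequences range.\<close>

definition strongly_converging ::
    "'o::{wellorder, linorder_topology} itself \<Rightarrow> ('f, 'v) itrs \<Rightarrow> bool" where
  "strongly_converging _ R \<longleftrightarrow>
     (\<forall>(\<alpha>::'o) f ps. limit_ordinal \<alpha> \<and> reduction_sequence R \<alpha> f ps \<longrightarrow>
        (\<forall>p. \<exists>\<beta><\<alpha>. \<forall>\<gamma>. \<beta> \<le> \<gamma> \<and> \<gamma> < \<alpha> \<longrightarrow> ps \<gamma> \<noteq> p))"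

end

theory Submission
  imports Defs
begin

text \<open>Suppose redexes are contracted cofinally often at some position, and let \<open>p\<close> be a shortest such
  position. From some point on no step contracts a redex strictly above \<open>p\<close>, so the subterms at \<open>p\<close>
  form a sequence with cofinally many root steps. Since no rule collapses, their root symbols stay in
  one of the two signatures, say that of \<open>R\<close>. Replace every maximal subterm whose root is foreign to
  \<open>R\<close> by one and the same variable: as rules of \<open>R\<close> contain no foreign symbols, \<open>R\<close>-steps in the top
  layer survive (left-linear or not), and all other steps become equalities. Deleting the
  equalities gives an open reduction sequence of \<open>R\<close> with cofinally many root steps, a
  contradiction.\<close>

section \<open>Well-ordered types\<close>

lemma ord_succ_gt: "\<beta> < \<gamma> \<Longrightarrow> \<beta> < ord_succ \<beta>"
  unfolding ord_succ_def by (rule LeastI)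

lemma ord_succ_le: "\<beta> < \<gamma> \<Longrightarrow> ord_succ \<beta> \<le> \<gamma>"
  unfolding ord_succ_def by (rule Least_le)

text \<open>The second alternative covers limits and also the least element, where it holds
  vacuously.\<close>

lemma ord_succ_cases:
  fixes \<gamma> :: "'o::wellorder"
  obtains \<eta> where "\<eta> < \<gamma>" "\<gamma> = ord_succ \<eta>" | "\<forall>\<eta><\<gamma>. ord_succ \<eta> < \<gamma>"
  using ord_succ_le by (metis order.not_eq_order_implies_strict)

lemma limit_ordinalD: "limit_ordinal \<alpha> \<Longrightarrow> \<beta> < \<alpha> \<Longrightarrow> ord_succ \<beta> < \<alpha>"
  by (simp add: limit_ordinal_def)

text \<open>The Mostowski collapse of \<open>A\<close>: the value at \<open>\<gamma>\<close> is the
  order type of the part of \<open>A\<close> below \<open>\<gamma>\<close>, represented in the same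
  well-ordered type.\<close>

function order_collapse :: "'o::wellorder set \<Rightarrow> 'o \<Rightarrow> 'o" where
  "order_collapse A \<gamma> = (LEAST x. \<forall>\<eta>\<in>{\<eta>\<in>A. \<eta> < \<gamma>}. order_collapse A \<eta> < x)"
  by auto
termination
  by (relation "inv_image {(x, y). x < y} snd") (auto simp: wf)

declare order_collapse.simps [simp del]

lemma order_collapse_le: "order_collapse A \<gamma> \<le> \<gamma>"
proof (induction \<gamma> rule: less_induct)
  case (less \<gamma>)
  then show ?case
    by (subst order_collapse.simps) (auto intro!: Least_le intro: le_less_trans)
qed

text \<open>By \<open>order_collapse_le\<close>, \<open>\<gamma>\<close> itself satisfies the
  condition under the \<open>LEAST\<close>, so the value at \<open>\<gamma>\<close> really is a
  strict upper bound.\<close>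

lemma order_collapse_less:
  assumes "\<eta> \<in> A" "\<eta> < \<gamma>"
  shows "order_collapse A \<eta> < order_collapse A \<gamma>"
proof -
  have "\<forall>\<eta>\<in>{\<eta>\<in>A. \<eta> < \<gamma>}. order_collapse A \<eta> < order_collapse A \<gamma>"
    by (subst (2) order_collapse.simps, rule LeastI[of _ \<gamma>])
      (auto intro: le_less_trans[OF order_collapse_le])
  with assms show ?thesis by blast
qed

text \<open>The values leave no gaps: \<open>y\<close> lies below the least strict upper bound, so
  some earlier element of \<open>A\<close> has a value at least \<open>y\<close>. Either that value
  is \<open>y\<close>, or the search continues below this element.\<close>

lemma order_collapse_image:
  "y < order_collapse A \<gamma> \<Longrightarrow> \<exists>\<eta>\<in>A. \<eta> < \<gamma> \<and> order_collapse A \<eta> = y"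
proof (induction \<gamma> rule: less_induct)
  case (less \<gamma>)
  have "\<not> (\<forall>\<eta>\<in>{\<eta>\<in>A. \<eta> < \<gamma>}. order_collapse A \<eta> < y)"
    using less.prems by (subst (asm) order_collapse.simps) (rule not_less_Least)
  then obtain \<eta> where \<eta>: "\<eta> \<in> A" "\<eta> < \<gamma>" "y \<le> order_collapse A \<eta>"
    by (auto simp: not_less)
  then show ?case
    using less.IH[OF \<eta>(2)] by (metis order.order_iff_strict less_trans)
qed

text \<open>Here \<open>\<delta>\<close> is the order type of \<open>A\<close> and \<open>e\<close>
  its increasing enumeration, the inverse of the collapse. Since the collapse never exceeds its
  argument, \<open>\<delta> \<le> \<alpha>\<close>, so deleting stages from a sequence requires no
  larger type of ordinals.\<close>

lemma order_type_of_subset: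
  fixes A :: "'o::wellorder set"
  assumes "A \<subseteq> {..<\<alpha>}"
  obtains \<delta> e where "\<delta> \<le> \<alpha>" "bij_betw e {..<\<delta>} A" "strict_mono_on {..<\<delta>} e"
proof -
  let ?c = "order_collapse A"
  define \<delta> where "\<delta> = (LEAST x. x \<notin> ?c ` A)"
  have \<alpha>: "\<alpha> \<notin> ?c ` A"
    using assms order_collapse_le[of A] by (metis image_iff lessThan_iff not_le subsetD)
  then have \<delta>: "\<delta> \<notin> ?c ` A" "\<delta> \<le> \<alpha>"
    unfolding \<delta>_def by (rule LeastI, rule Least_le)
  have "?c ` A = {..<\<delta>}"
  proof (intro equalityI subsetI)
    fix x assume x: "x \<in> ?c ` A"
    then have "\<not> \<delta> \<le> x"
      using \<delta>(1) order_collapse_image by (metis image_iff order.order_iff_strict)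
    then show "x \<in> {..<\<delta>}" by simp
  next
    fix x assume "x \<in> {..<\<delta>}"
    then show "x \<in> ?c ` A"
      unfolding \<delta>_def using not_less_Least by blast
  qed
  moreover have "inj_on ?c A"
    by (rule inj_onI) (metis order_collapse_less less_irrefl linorder_less_linear)
  ultimately have bij: "bij_betw ?c A {..<\<delta>}" by (simp add: bij_betw_def)
  let ?e = "inv_into A ?c"
  have bij': "bij_betw ?e {..<\<delta>} A" using bij by (rule bij_betw_inv_into)
  moreover have "strict_mono_on {..<\<delta>} ?e"
  proof (rule strict_mono_onI)
    fix x y assume xy: "x \<in> {..<\<delta>}" "y \<in> {..<\<delta>}" "x < y"
    then have "?e x \<in> A" "?e y \<in> A" "?c (?e x) = x" "?c (?e y) = y"
      using bij bij' by (auto simp: bij_betw_inv_into_right dest: bij_betwE)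
    then show "?e x < ?e y"
      using xy(3) order_collapse_less by (metis less_asym linorder_less_linear)
  qed
  ultimately show ?thesis using that \<delta>(2) by blast
qed

section \<open>Continuity of sequences of terms\<close>

text \<open>The element \<open>\<eta>\<close> witnesses that \<open>\<gamma>\<close> is not least,
  which \<open>eventually_at_left\<close> requires.\<close>

lemma continuous_on_agree:
  fixes f :: "'o::{wellorder, linorder_topology} \<Rightarrow> ('f, 'v) iterm"
  assumes "continuous_on {..<\<alpha>} f" "\<eta> < \<gamma>" "\<gamma> < \<alpha>"
  obtains b where "b < \<gamma>" "\<And>x. b < x \<Longrightarrow> x < \<gamma> \<Longrightarrow> agree n (f x) (f \<gamma>)"
proof -
  have "(f \<longlongrightarrow> f \<gamma>) (at \<gamma> within {..<\<alpha>})"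
    using assms by (auto simp: continuous_on_def)
  then have "(f \<longlongrightarrow> f \<gamma>) (at_left \<gamma>)"
    by (rule tendsto_within_subset) (use assms in auto)
  then have "eventually (\<lambda>x. dist (f x) (f \<gamma>) < (1/2) ^ n) (at_left \<gamma>)"
    by (rule tendstoD) simp
  then obtain b where "b < \<gamma>" "\<And>x. b < x \<Longrightarrow> x < \<gamma> \<Longrightarrow> dist (f x) (f \<gamma>) < (1/2) ^ n"
    using assms(2) by (auto simp: eventually_at_left)
  then show ?thesis
    using that by (metis dist_iterm_le_iff less_imp_le)
qed

text \<open>The open set \<open>{..<ord_succ \<gamma>}\<close> contains \<open>\<gamma>\<close> and
  nothing above it, so continuity at \<open>\<gamma>\<close> is a condition from the left. At a
  successor it is met by taking the predecessor for \<open>b\<close>.\<close>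

lemma continuous_on_agreeI:
  fixes f :: "'o::{wellorder, linorder_topology} \<Rightarrow> ('f, 'v) iterm"
  assumes "\<And>\<gamma> \<eta> n. \<eta> < \<gamma> \<Longrightarrow> \<gamma> < \<alpha> \<Longrightarrow> \<exists>b<\<gamma>. \<forall>x. b < x \<and> x < \<gamma> \<longrightarrow> agree n (f x) (f \<gamma>)"
  shows "continuous_on {..<\<alpha>} f"
  unfolding continuous_on_def
proof
  fix \<gamma> assume \<gamma>: "\<gamma> \<in> {..<\<alpha>}"
  have "at \<gamma> within {..<\<alpha>} = at \<gamma> within {..<\<gamma>}"
  proof (rule at_within_nhd[of _ "{..<ord_succ \<gamma>}"])
    show "\<gamma> \<in> {..<ord_succ \<gamma>}" using \<gamma> ord_succ_gt by auto
    have "x \<le> \<gamma>" if "x < ord_succ \<gamma>" for x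
      using that ord_succ_le[of \<gamma> x] by (meson leD not_le)
    then show "{..<\<alpha>} \<inter> {..<ord_succ \<gamma>} - {\<gamma>} = {..<\<gamma>} \<inter> {..<ord_succ \<gamma>} - {\<gamma>}"
      using \<gamma> by force
  qed simp
  moreover have "(f \<longlongrightarrow> f \<gamma>) (at_left \<gamma>)"
  proof (cases "\<exists>\<eta>. \<eta> < \<gamma>")
    case True
    then obtain \<eta> where \<eta>: "\<eta> < \<gamma>" by blast
    show ?thesis
    proof (rule tendstoI)
      fix e :: real assume "0 < e"
      then obtain n where n: "(1/2) ^ n < e" using pow_half_less by blast
      obtain b where "b < \<gamma>" "\<And>x. b < x \<Longrightarrow> x < \<gamma> \<Longrightarrow> agree n (f x) (f \<gamma>)"
        using assms[OF \<eta>] \<gamma> by blast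
      then show "eventually (\<lambda>x. dist (f x) (f \<gamma>) < e) (at_left \<gamma>)"
        unfolding eventually_at_left[OF \<eta>] dist_iterm_le_iff[symmetric]
        using n by (meson le_less_trans)
    qed
  next
    case False
    then have "{..<\<gamma>} = {}" by auto
    then show ?thesis by (simp add: at_within_def)
  qed
  ultimately show "(f \<longlongrightarrow> f \<gamma>) (at \<gamma> within {..<\<alpha>})" by simp
qed

section \<open>Reduction sequences with stuttering\<close>

text \<open>Take the least \<open>c\<close> such that \<open>g\<close> agrees with
  \<open>g b\<close> to depth \<open>n\<close> on all of \<open>c\<close> to \<open>b\<close>. If
  \<open>c\<close> is beyond \<open>\<beta>\<close>, it is no limit, by \<open>lim\<close>, and its
  predecessor lies in \<open>A\<close>, as an equality there would allow a smaller
  \<open>c\<close>.\<close>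

lemma agree_back_to_proper_step:
  fixes g :: "'o::wellorder \<Rightarrow> ('f, 'v) iterm"
  assumes lim: "\<And>\<gamma>. \<beta> < \<gamma> \<Longrightarrow> \<gamma> \<le> b \<Longrightarrow> \<forall>\<eta><\<gamma>. ord_succ \<eta> < \<gamma> \<Longrightarrow>
        \<exists>c<\<gamma>. \<forall>\<eta>. c < \<eta> \<and> \<eta> < \<gamma> \<and> \<beta> \<le> \<eta> \<longrightarrow> agree n (g \<eta>) (g \<gamma>)"
    and stutter: "\<And>\<gamma>. \<beta> \<le> \<gamma> \<Longrightarrow> \<gamma> < b \<Longrightarrow> \<gamma> \<notin> A \<Longrightarrow> g (ord_succ \<gamma>) = g \<gamma>"
    and b: "\<beta> \<le> b"
  shows "(\<forall>\<gamma>. \<beta> \<le> \<gamma> \<and> \<gamma> \<le> b \<longrightarrow> agree n (g \<gamma>) (g b)) \<or>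
         (\<exists>a\<in>A. \<beta> \<le> a \<and> a < b \<and> (\<forall>\<gamma>. a < \<gamma> \<and> \<gamma> \<le> b \<longrightarrow> agree n (g \<gamma>) (g b)))"
proof -
  define P where "P c \<longleftrightarrow> \<beta> \<le> c \<and> c \<le> b \<and> (\<forall>\<gamma>. c \<le> \<gamma> \<and> \<gamma> \<le> b \<longrightarrow> agree n (g \<gamma>) (g b))" for c
  define c where "c = (LEAST c. P c)"
  have "P b" using b by (auto simp: P_def)
  then have c: "P c" unfolding c_def by (rule LeastI)
  have c_least: "c \<le> x" if "P x" for x unfolding c_def using that by (rule Least_le)
  have cD: "\<beta> \<le> c" "c \<le> b" "\<And>\<gamma>. c \<le> \<gamma> \<Longrightarrow> \<gamma> \<le> b \<Longrightarrow> agree n (g \<gamma>) (g b)"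
    using c by (auto simp: P_def)
  show ?thesis
  proof (cases "c = \<beta>")
    case True
    then show ?thesis using cD by blast
  next
    case False
    then have \<beta>c: "\<beta> < c" using cD by simp
    show ?thesis
    proof (cases c rule: ord_succ_cases)
      case (1 a)
      have above: "c \<le> \<gamma>" if "a < \<gamma>" for \<gamma> using that 1 ord_succ_le by blast
      have "\<beta> \<le> a" using above \<beta>c by (meson leD not_le)
      moreover have "a \<in> A"
      proof (rule ccontr)
        assume "a \<notin> A"
        then have "g c = g a" using stutter[of a] 1 cD \<open>\<beta> \<le> a\<close> by auto
        then have "agree n (g \<gamma>) (g b)" if "a \<le> \<gamma>" "\<gamma> \<le> b" for \<gamma>
          using that cD(2) cD(3)[of \<gamma>] cD(3)[of c] above[of \<gamma>] by (cases "\<gamma> = a") auto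
        then have "P a" using \<open>\<beta> \<le> a\<close> 1 cD by (auto simp: P_def)
        then show False using c_least 1 by (meson leD)
      qed
      ultimately show ?thesis using 1 cD above by (meson less_le_trans)
    next
      case 2
      then obtain d where d: "d < c" "\<And>\<eta>. d < \<eta> \<Longrightarrow> \<eta> < c \<Longrightarrow> \<beta> \<le> \<eta> \<Longrightarrow> agree n (g \<eta>) (g c)"
        using lim[OF \<beta>c cD(2)] by blast
      \<comment> \<open>A point strictly between \<open>d\<close> and \<open>c\<close>, not before
        \<open>\<beta>\<close>; agreement already starts there, against minimality of
        \<open>c\<close>.\<close>
      define x where "x = max \<beta> (ord_succ d)"
      have x: "x < c" "d < x" "\<beta> \<le> x"
        using \<beta>c 2 d ord_succ_gt[OF d(1)] by (auto simp: x_def less_max_iff_disj)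
      have "agree n (g \<gamma>) (g b)" if "x \<le> \<gamma>" "\<gamma> \<le> b" for \<gamma>
      proof (cases "c \<le> \<gamma>")
        case False
        then have "agree n (g \<gamma>) (g c)" using d(2)[of \<gamma>] that x by auto
        then show ?thesis using cD(3)[of c] cD(2) agree_trans by blast
      qed (use that cD in blast)
      then have "P x" using x cD by (auto simp: P_def)
      then show ?thesis using c_least x by (meson leD)
    qed
  qed
qed

text \<open>Enumerating \<open>A\<close> increasingly by \<open>e\<close> turns \<open>g\<close>
  into a genuine reduction sequence of \<open>R\<close>. Unboundedness of \<open>A\<close> makes its
  length a limit ordinal, so strong convergence applies.\<close>

lemma strongly_converging_stuttering:
  fixes R :: "('f, 'v) itrs" and \<alpha> :: "'o::{wellorder, linorder_topology}"
  assumes sc: "strongly_converging TYPE('o) R"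
    and ter: "\<And>\<gamma>. \<beta> \<le> \<gamma> \<Longrightarrow> \<gamma> < \<alpha> \<Longrightarrow> g \<gamma> \<in> Ter (sig R)"
    and lim: "\<And>\<gamma> n. \<beta> < \<gamma> \<Longrightarrow> \<gamma> < \<alpha> \<Longrightarrow> \<forall>\<eta><\<gamma>. ord_succ \<eta> < \<gamma> \<Longrightarrow>
        \<exists>c<\<gamma>. \<forall>\<eta>. c < \<eta> \<and> \<eta> < \<gamma> \<and> \<beta> \<le> \<eta> \<longrightarrow> agree n (g \<eta>) (g \<gamma>)"
    and stutter: "\<And>\<gamma>. \<beta> \<le> \<gamma> \<Longrightarrow> \<gamma> < \<alpha> \<Longrightarrow> \<gamma> \<notin> A \<Longrightarrow> g (ord_succ \<gamma>) = g \<gamma>"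
    and proper: "\<And>\<gamma>. \<gamma> \<in> A \<Longrightarrow> rewrite_step R (qs \<gamma>) (g \<gamma>) (g (ord_succ \<gamma>))"
    and A: "A \<subseteq> {\<beta>..<\<alpha>}"
    and \<beta>: "\<beta> < \<alpha>"
    and unbounded: "\<And>\<gamma>. \<gamma> < \<alpha> \<Longrightarrow> \<exists>\<eta>\<in>A. \<gamma> < \<eta>"
  shows "\<exists>\<gamma><\<alpha>. \<forall>\<eta>\<in>A. \<gamma> \<le> \<eta> \<longrightarrow> qs \<eta> \<noteq> q"
proof -
  obtain \<delta> e where \<delta>: "\<delta> \<le> \<alpha>" and bij: "bij_betw e {..<\<delta>} A" and mono: "strict_mono_on {..<\<delta>} e"
    using A by (elim order_type_of_subset[of A \<alpha>, rotated]) auto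
  have eA: "e \<xi> \<in> A" "\<beta> \<le> e \<xi>" "e \<xi> < \<alpha>" if "\<xi> < \<delta>" for \<xi>
    using bij A that by (auto dest!: bij_betwE)
  have e_less: "e \<xi> < e \<zeta> \<longleftrightarrow> \<xi> < \<zeta>" if "\<xi> < \<delta>" "\<zeta> < \<delta>" for \<xi> \<zeta>
    using mono that by (simp add: strict_mono_on_less)
  have e_onto: "\<exists>\<xi><\<delta>. a = e \<xi>" if "a \<in> A" for a
    using bij that by (auto simp: bij_betw_def)
  \<comment> \<open>The preceding lemma in terms of indices: proper steps before
    \<open>e \<zeta>\<close> are the \<open>e \<xi>\<close> with
    \<open>\<xi> < \<zeta>\<close>.\<close>
  have back_to: "(\<forall>\<gamma>. \<beta> \<le> \<gamma> \<and> \<gamma> \<le> e \<zeta> \<longrightarrow> agree n (g \<gamma>) (g (e \<zeta>))) \<or>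
      (\<exists>\<xi><\<zeta>. \<forall>\<gamma>. e \<xi> < \<gamma> \<and> \<gamma> \<le> e \<zeta> \<longrightarrow> agree n (g \<gamma>) (g (e \<zeta>)))" if \<zeta>: "\<zeta> < \<delta>" for \<zeta> n
  proof -
    have "\<exists>\<xi><\<zeta>. a = e \<xi>" if "a \<in> A" "a < e \<zeta>" for a
      using e_onto[OF that(1)] that(2) e_less \<zeta> by auto
    moreover have "(\<forall>\<gamma>. \<beta> \<le> \<gamma> \<and> \<gamma> \<le> e \<zeta> \<longrightarrow> agree n (g \<gamma>) (g (e \<zeta>))) \<or>
        (\<exists>a\<in>A. \<beta> \<le> a \<and> a < e \<zeta> \<and> (\<forall>\<gamma>. a < \<gamma> \<and> \<gamma> \<le> e \<zeta> \<longrightarrow> agree n (g \<gamma>) (g (e \<zeta>))))"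
      using eA(2,3)[OF \<zeta>] by (intro agree_back_to_proper_step lim stutter) auto
    ultimately show ?thesis by blast
  qed
  have limit: "limit_ordinal \<delta>"
    unfolding limit_ordinal_def
  proof (intro conjI allI impI)
    show "\<exists>\<xi>. \<xi> < \<delta>" using unbounded[OF \<beta>] e_onto by blast
    fix \<xi> assume \<xi>: "\<xi> < \<delta>"
    then obtain \<eta> where "\<eta> \<in> A" "e \<xi> < \<eta>" using unbounded eA by blast
    then obtain \<zeta> where "\<zeta> < \<delta>" "\<xi> < \<zeta>" using e_onto e_less \<xi> by blast
    then show "ord_succ \<xi> < \<delta>" using ord_succ_le le_less_trans by blast
  qed
  have "reduction_sequence R \<delta> (\<lambda>\<xi>. g (e \<xi>)) (\<lambda>\<xi>. qs (e \<xi>))"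
    unfolding reduction_sequence_def
  proof (intro conjI allI impI)
    show "(\<lambda>\<xi>. g (e \<xi>)) ` {..<\<delta>} \<subseteq> Ter (sig R)" using ter eA by auto
    show "continuous_on {..<\<delta>} (\<lambda>\<xi>. g (e \<xi>))"
    proof (rule continuous_on_agreeI)
      fix \<zeta> \<eta> :: 'o and n assume \<zeta>: "\<eta> < \<zeta>" "\<zeta> < \<delta>"
      show "\<exists>b<\<zeta>. \<forall>x. b < x \<and> x < \<zeta> \<longrightarrow> agree n (g (e x)) (g (e \<zeta>))"
        using back_to[OF \<zeta>(2), of n]
      proof
        assume "\<forall>\<gamma>. \<beta> \<le> \<gamma> \<and> \<gamma> \<le> e \<zeta> \<longrightarrow> agree n (g \<gamma>) (g (e \<zeta>))"
        then show ?thesis using \<zeta> eA e_less by (meson less_imp_le less_trans)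
      next
        assume "\<exists>\<xi><\<zeta>. \<forall>\<gamma>. e \<xi> < \<gamma> \<and> \<gamma> \<le> e \<zeta> \<longrightarrow> agree n (g \<gamma>) (g (e \<zeta>))"
        then show ?thesis using \<zeta> e_less by (meson less_imp_le less_trans)
      qed
    qed
    fix \<xi> assume \<xi>: "\<xi> < \<delta>" "ord_succ \<xi> < \<delta>"
    have less: "e \<xi> < e (ord_succ \<xi>)" using \<xi> e_less ord_succ_gt by blast
    then have succ: "e \<xi> < ord_succ (e \<xi>)" "ord_succ (e \<xi>) \<le> e (ord_succ \<xi>)"
      using ord_succ_gt ord_succ_le by blast+
    \<comment> \<open>Between two consecutive proper steps \<open>g\<close> must be constant, also
      across limits; this is checked depth by depth.\<close>
    have "agree n (g (ord_succ (e \<xi>))) (g (e (ord_succ \<xi>)))" for n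
      using back_to[OF \<xi>(2), of n]
    proof
      assume "\<forall>\<gamma>. \<beta> \<le> \<gamma> \<and> \<gamma> \<le> e (ord_succ \<xi>) \<longrightarrow> agree n (g \<gamma>) (g (e (ord_succ \<xi>)))"
      then show ?thesis using succ eA(2)[OF \<xi>(1)] by (meson less_imp_le order.trans)
    next
      assume "\<exists>\<zeta><ord_succ \<xi>. \<forall>\<gamma>. e \<zeta> < \<gamma> \<and> \<gamma> \<le> e (ord_succ \<xi>) \<longrightarrow> agree n (g \<gamma>) (g (e (ord_succ \<xi>)))"
      then obtain \<zeta> where \<zeta>: "\<zeta> < ord_succ \<xi>"
        "\<And>\<gamma>. e \<zeta> < \<gamma> \<Longrightarrow> \<gamma> \<le> e (ord_succ \<xi>) \<Longrightarrow> agree n (g \<gamma>) (g (e (ord_succ \<xi>)))" by blast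
      \<comment> \<open>An index below \<open>ord_succ \<xi>\<close> is at most
        \<open>\<xi>\<close>, so the agreement reaches back to just after
        \<open>e \<xi>\<close>.\<close>
      have "\<not> \<xi> < \<zeta>" using \<zeta>(1) ord_succ_le by (meson leD)
      then have "\<not> e \<xi> < e \<zeta>" using e_less \<xi> \<zeta>(1) less_trans by blast
      then show ?thesis using \<zeta>(2) succ by (meson not_less le_less_trans)
    qed
    then have "g (ord_succ (e \<xi>)) = g (e (ord_succ \<xi>))" by (rule agree_all_eq)
    then show "rewrite_step R (qs (e \<xi>)) (g (e \<xi>)) (g (e (ord_succ \<xi>)))"
      using proper[OF eA(1)[OF \<xi>(1)]] by simp
  qed
  with sc limit obtain \<xi> where \<xi>: "\<xi> < \<delta>" "\<And>\<zeta>. \<xi> \<le> \<zeta> \<Longrightarrow> \<zeta> < \<delta> \<Longrightarrow> qs (e \<zeta>) \<noteq> q"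
    unfolding strongly_converging_def by meson
  have "qs \<eta> \<noteq> q" if "\<eta> \<in> A" "e \<xi> \<le> \<eta>" for \<eta>
    using e_onto[OF that(1)] that(2) e_less \<xi> by (metis not_less)
  then show ?thesis using eA(3)[OF \<xi>(1)] by blast
qed

section \<open>Steps and subterms\<close>

lemma subst_simps [simp]:
  "subst \<theta> (Var x) = \<theta> x"
  "subst \<theta> (Fun f ts) = Fun f (map (subst \<theta>) ts)"
  by (subst subst.code, simp)+

lemma rewrite_step_Nil:
  "rewrite_step X [] t u \<longleftrightarrow>
     (\<exists>l r \<theta>. (l, r) \<in> rules X \<and> range \<theta> \<subseteq> Ter (sig X) \<and> t = subst \<theta> l \<and> u = subst \<theta> r)"
  by (simp add: rewrite_step_def)

lemma rewrite_step_Cons: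
  "rewrite_step X (i # q) t u \<longleftrightarrow>
     (\<exists>f ts u'. t = Fun f ts \<and> i < length ts \<and> rewrite_step X q (ts ! i) u' \<and> u = Fun f (ts[i := u']))"
  by (cases t) (auto simp: rewrite_step_def)

lemma is_pos_agree:
  "agree (length p + Suc n) t u \<Longrightarrow> is_pos p t \<Longrightarrow> is_pos p u"
proof (induction p arbitrary: t u)
  case (Cons i p)
  then show ?case by (cases t; cases u) (auto simp: list_all2_conv_all_nth)
qed simp

lemma subterm_at_agree:
  "agree (length p + n) t u \<Longrightarrow> is_pos p t \<Longrightarrow> agree n (subterm_at p t) (subterm_at p u)"
proof (induction p arbitrary: t u)
  case (Cons i p)
  then show ?case by (cases t; cases u) (auto simp: list_all2_conv_all_nth)
qed simp

lemma subterm_at_Ter: "t \<in> Ter \<Sigma> \<Longrightarrow> is_pos p t \<Longrightarrow> subterm_at p t \<in> Ter \<Sigma>"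
proof (induction p arbitrary: t)
  case (Cons i p)
  then show ?case by (cases t) (auto simp: Fun_in_Ter subset_iff)
qed simp

text \<open>Since \<open>q\<close> is no proper prefix of \<open>p\<close>, it is either parallel to
  \<open>p\<close> or extends it. The conjunct on \<open>take\<close> later excludes the parallel
  case for \<open>q = p\<close>.\<close>

lemma rewrite_step_not_above:
  assumes "rewrite_step X q t u" "is_pos p t" "\<forall>k<length p. q \<noteq> take k p"
  shows "is_pos p u \<and> (subterm_at p u = subterm_at p t \<and> take (length p) q \<noteq> p \<or>
    (\<exists>q'. q = p @ q' \<and> rewrite_step X q' (subterm_at p t) (subterm_at p u)))"
  using assms
proof (induction p arbitrary: q t u)
  case (Cons i p)
  from Cons.prems(3) obtain j q' where q: "q = j # q'" by (cases q) force+
  with Cons.prems obtain f ts u' where t: "t = Fun f ts" "j < length ts"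
    "rewrite_step X q' (ts ! j) u'" "u = Fun f (ts[j := u'])" "i < length ts" "is_pos p (ts ! i)"
    by (auto simp: rewrite_step_Cons)
  show ?case
  proof (cases "j = i")
    case True
    have "\<forall>k<length p. q' \<noteq> take k p"
      using Cons.prems(3) q True by (metis Suc_less_eq length_Cons take_Suc_Cons)
    with Cons.IH[of q' "ts ! i" u'] t True q show ?thesis by auto
  next
    case False
    then show ?thesis using t q by auto
  qed
qed simp

section \<open>The top layer of a term\<close>

definition rooted_in :: "'f set \<Rightarrow> ('f, 'v) iterm \<Rightarrow> bool" where
  "rooted_in D t \<longleftrightarrow> (\<exists>f ts. t = Fun f ts \<and> f \<in> D)"

text \<open>All foreign subterms become the same (arbitrary) variable; no supply of fresh variables is needed.\<close>

primcorec top_layer :: "'f set \<Rightarrow> ('f, 'v) iterm \<Rightarrow> ('f, 'v) iterm" where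
  "top_layer D t =
     (if rooted_in D t then Fun (un_Fun1 t) (map (top_layer D) (args t))
      else Var (if is_Var t then un_Var t else undefined))"

lemma top_layer_simps [simp]:
  "top_layer D (Var x) = Var x"
  "f \<in> D \<Longrightarrow> top_layer D (Fun f ts) = Fun f (map (top_layer D) ts)"
  "f \<notin> D \<Longrightarrow> top_layer D (Fun f ts) = Var undefined"
  by (subst top_layer.code, simp add: rooted_in_def)+

lemma rooted_in_agree: "agree (Suc n) t u \<Longrightarrow> rooted_in D t \<Longrightarrow> rooted_in D u"
  by (cases u) (auto simp: rooted_in_def)

lemma rooted_in_subst: "\<not> is_Var t \<Longrightarrow> rooted_in D (subst \<theta> t) \<longleftrightarrow> rooted_in D t"
  by (cases t) (auto simp: rooted_in_def)

lemma top_layer_not_rooted_in: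
  "\<not> is_Var t \<Longrightarrow> \<not> rooted_in D t \<Longrightarrow> top_layer D t = Var undefined"
  by (cases t) (auto simp: rooted_in_def)

lemma rooted_in_Ter: "t \<in> Ter \<Sigma> \<Longrightarrow> \<not> is_Var t \<Longrightarrow> rooted_in (dom \<Sigma>) t"
  by (cases t) (auto simp: rooted_in_def Fun_in_Ter)

text \<open>Cutting is non-expansive for the metric, hence it preserves continuity of
  sequences.\<close>

lemma top_layer_agree: "agree n t u \<Longrightarrow> agree n (top_layer D t) (top_layer D u)"
proof (induction n arbitrary: t u)
  case (Suc n)
  show ?case
  proof (cases t)
    case (Var x)
    then show ?thesis using Suc.prems by (cases u) auto
  next
    case (Fun f ts)
    then obtain us where "u = Fun f us" "list_all2 (agree n) ts us"
      using Suc.prems by (cases u) auto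
    then show ?thesis using Fun Suc.IH
      by (cases "f \<in> D") (auto simp: list_all2_conv_all_nth)
  qed
qed simp

lemma top_layer_Ter:
  assumes "t \<in> Ter \<Sigma>'" "\<And>f. f \<in> dom \<Sigma> \<Longrightarrow> \<Sigma>' f = \<Sigma> f"
  shows "top_layer (dom \<Sigma>) t \<in> Ter \<Sigma>"
  using assms(1)
proof (coinduction arbitrary: t)
  case Ter
  then show ?case
  proof cases
    case (Ter_Fun f ts)
    then show ?thesis using assms(2)[of f] by (cases "f \<in> dom \<Sigma>") auto
  qed simp
qed

text \<open>As \<open>t\<close> has no foreign symbol, every cut falls inside the substituted terms.
  Repeated variables receive equal cut terms, so matching of non-linear left-hand sides
  survives.\<close>

lemma top_layer_subst:
  assumes "t \<in> Ter \<Sigma>"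
  shows "top_layer (dom \<Sigma>) (subst \<theta> t) = subst (\<lambda>x. top_layer (dom \<Sigma>) (\<theta> x)) t"
proof (rule agree_all_eq)
  fix n
  show "agree n (top_layer (dom \<Sigma>) (subst \<theta> t)) (subst (\<lambda>x. top_layer (dom \<Sigma>) (\<theta> x)) t)"
    using assms
  proof (induction n arbitrary: t)
    case (Suc n)
    from Suc.prems show ?case
    proof cases
      case (Ter_Var x)
      then show ?thesis by (simp del: agree.simps)
    next
      case (Ter_Fun f ts)
      then have "f \<in> dom \<Sigma>" by auto
      then show ?thesis using Ter_Fun Suc.IH by (auto simp: list_all2_conv_all_nth)
    qed
  qed simp
qed

section \<open>Steps and reductions in a disjoint union\<close>

lemma disjoint_union_commute:
  "dom (sig R) \<inter> dom (sig S) = {} \<Longrightarrow> disjoint_union R S = disjoint_union S R"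
  by (simp add: disjoint_union_def map_add_comm[of "sig R"] Un_commute)

locale disjoint_itrs =
  fixes R S :: "('f, 'v) itrs"
  assumes wf: "wf_itrs R" "wf_itrs S"
    and disjoint: "dom (sig R) \<inter> dom (sig S) = {}"
    and nc: "non_collapsing R" "non_collapsing S"
begin

abbreviation "U \<equiv> disjoint_union R S"
abbreviation "D \<equiv> dom (sig R)"

lemma sig_U: "f \<in> D \<Longrightarrow> sig U f = sig R f"
  using disjoint by (auto simp: disjoint_union_def map_add_def split: option.split)

text \<open>Non-collapsingness enters here: both sides of a rule have a root symbol, and both
  symbols come from the signature of the same system.\<close>

lemma rule_cases:
  assumes "(l, r) \<in> rules U"
  obtains "(l, r) \<in> rules R" "l \<in> Ter (sig R)" "r \<in> Ter (sig R)" "\<not> is_Var l" "\<not> is_Var r"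
      "rooted_in D l" "rooted_in D r"
  | "(l, r) \<in> rules S" "\<not> is_Var l" "\<not> is_Var r" "\<not> rooted_in D l" "\<not> rooted_in D r"
proof (cases "(l, r) \<in> rules R")
  case True
  then have "l \<in> Ter (sig R)" "r \<in> Ter (sig R)" "\<not> is_Var l" "\<not> is_Var r"
    using wf nc by (auto simp: wf_itrs_def non_collapsing_def)
  then show ?thesis using that(1) True rooted_in_Ter by blast
next
  case False
  then have S: "(l, r) \<in> rules S" using assms by (simp add: disjoint_union_def)
  then have "l \<in> Ter (sig S)" "r \<in> Ter (sig S)" "\<not> is_Var l" "\<not> is_Var r"
    using wf nc by (auto simp: wf_itrs_def non_collapsing_def)
  moreover then have "rooted_in (dom (sig S)) l" "rooted_in (dom (sig S)) r"
    using rooted_in_Ter by blast+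
  ultimately show ?thesis using that(2) S disjoint by (fastforce simp: rooted_in_def)
qed

text \<open>A root step takes the new root from a right-hand side, which by
  \<open>rule_cases\<close> has its root in the same signature; a collapsing rule could expose a
  foreign subterm. Deeper steps keep the root symbol.\<close>

lemma rewrite_step_rooted:
  assumes "rewrite_step U q t u" "rooted_in D t"
  shows "rooted_in D u"
proof (cases q)
  case Nil
  then obtain l r \<theta> where lr: "(l, r) \<in> rules U" "t = subst \<theta> l" "u = subst \<theta> r"
    using assms(1) by (auto simp: rewrite_step_Nil)
  from lr(1) show ?thesis
    by (cases rule: rule_cases) (use assms(2) lr rooted_in_subst in blast)+
next
  case (Cons i q')
  then show ?thesis using assms by (auto simp: rewrite_step_Cons rooted_in_def)
qed

lemma top_layer_root_step:
  assumes "(l, r) \<in> rules R" "l \<in> Ter (sig R)" "r \<in> Ter (sig R)" "range \<theta> \<subseteq> Ter (sig U)"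
  shows "rewrite_step R [] (top_layer D (subst \<theta> l)) (top_layer D (subst \<theta> r))"
  unfolding rewrite_step_Nil
proof (intro exI conjI)
  show "range (\<lambda>x. top_layer D (\<theta> x)) \<subseteq> Ter (sig R)"
    using assms(4) by (auto intro!: top_layer_Ter[of _ "sig U"] sig_U)
qed (use assms top_layer_subst in auto)

text \<open>A redex with root in \<open>D\<close> can only come from a rule of \<open>R\<close>.
  Hence root steps are never lost among the equalities.\<close>

lemma rewrite_step_root:
  assumes "rewrite_step U [] t u" "rooted_in D t"
  shows "rewrite_step R [] (top_layer D t) (top_layer D u)"
proof -
  obtain l r \<theta> where lr: "(l, r) \<in> rules U" "range \<theta> \<subseteq> Ter (sig U)" "t = subst \<theta> l" "u = subst \<theta> r"
    using assms(1) by (auto simp: rewrite_step_Nil)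
  from lr(1) show ?thesis
  proof (cases rule: rule_cases)
    case 1
    then show ?thesis using lr top_layer_root_step by blast
  next
    case 2
    then show ?thesis using lr assms(2) rooted_in_subst by blast
  qed
qed

text \<open>Redex and contractum of an \<open>S\<close>-rule both have foreign roots, so both are
  cut to \<open>Var undefined\<close>. Steps inside a foreign subterm vanish in the same
  way.\<close>

lemma rewrite_step_top_layer:
  assumes "rewrite_step U q t u"
  shows "top_layer D u = top_layer D t \<or> rewrite_step R q (top_layer D t) (top_layer D u)"
  using assms
proof (induction q arbitrary: t u)
  case Nil
  then obtain l r \<theta> where lr: "(l, r) \<in> rules U" "range \<theta> \<subseteq> Ter (sig U)" "t = subst \<theta> l" "u = subst \<theta> r"
    by (auto simp: rewrite_step_Nil)
  from lr(1) show ?case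
  proof (cases rule: rule_cases)
    case 1
    then show ?thesis using lr top_layer_root_step by blast
  next
    case 2
    then have "\<not> is_Var t" "\<not> is_Var u" using lr by (cases l; cases r; auto)+
    then show ?thesis using lr 2 rooted_in_subst top_layer_not_rooted_in by metis
  qed
next
  case (Cons i q)
  then obtain f ts u' where t: "t = Fun f ts" "i < length ts" "rewrite_step U q (ts ! i) u'"
    "u = Fun f (ts[i := u'])" by (auto simp: rewrite_step_Cons)
  show ?case
  proof (cases "f \<in> D")
    case True
    from Cons.IH[OF t(3)] show ?thesis
    proof
      assume "top_layer D u' = top_layer D (ts ! i)"
      then have "top_layer D u = top_layer D t"
        using True t by (simp add: map_update) (metis length_map list_update_id nth_map)
      then show ?thesis ..
    next
      assume "rewrite_step R q (top_layer D (ts ! i)) (top_layer D u')"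
      then have "rewrite_step R (i # q) (top_layer D t) (top_layer D u)"
        using True t unfolding rewrite_step_Cons by (auto simp: map_update)
      then show ?thesis ..
    qed
  next
    case False
    then show ?thesis using t by simp
  qed
qed

text \<open>Cofinal contractions at \<open>p\<close> are used twice: they make the proper steps of
  the top-layer sequence unbounded, and, being root steps there, they contradict strong convergence
  of \<open>R\<close>.\<close>

lemma not_cofinal_if_rooted:
  fixes \<alpha> :: "'o::{wellorder, linorder_topology}"
  assumes sc: "strongly_converging TYPE('o) R"
    and \<alpha>: "limit_ordinal \<alpha>" and red: "reduction_sequence U \<alpha> f ps"
    and \<beta>: "\<beta> < \<alpha>" "is_pos p (f \<beta>)" "rooted_in D (subterm_at p (f \<beta>))"
    and not_above: "\<And>\<gamma> k. \<beta> \<le> \<gamma> \<Longrightarrow> \<gamma> < \<alpha> \<Longrightarrow> k < length p \<Longrightarrow> ps \<gamma> \<noteq> take k p"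
  shows "\<exists>\<beta><\<alpha>. \<forall>\<gamma>. \<beta> \<le> \<gamma> \<and> \<gamma> < \<alpha> \<longrightarrow> ps \<gamma> \<noteq> p"
proof (rule ccontr)
  assume "\<not> ?thesis"
  then have cofinal: "\<exists>\<gamma>\<ge>\<xi>. \<gamma> < \<alpha> \<and> ps \<gamma> = p" if "\<xi> < \<alpha>" for \<xi> using that by blast
  have step: "rewrite_step U (ps \<gamma>) (f \<gamma>) (f (ord_succ \<gamma>))" if "\<gamma> < \<alpha>" for \<gamma>
    using red that limit_ordinalD[OF \<alpha>] by (auto simp: reduction_sequence_def)
  have cont: "continuous_on {..<\<alpha>} f" using red by (simp add: reduction_sequence_def)
  \<comment> \<open>Successor stages use that no step is strictly above \<open>p\<close> and that
    steps keep the root in \<open>D\<close>; limit stages use continuity.\<close>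
  have inv: "is_pos p (f \<gamma>) \<and> rooted_in D (subterm_at p (f \<gamma>))" if "\<beta> \<le> \<gamma>" "\<gamma> < \<alpha>" for \<gamma>
    using that
  proof (induction \<gamma> rule: less_induct)
    case (less \<gamma>)
    show ?case
    proof (cases "\<gamma> = \<beta>")
      case False
      then have less_\<gamma>: "\<beta> < \<gamma>" using less.prems by simp
      show ?thesis
      proof (cases \<gamma> rule: ord_succ_cases)
        case (1 \<eta>)
        have "\<beta> \<le> \<eta>" using 1 less_\<gamma> ord_succ_le[of \<eta> \<beta>] by (meson leD not_le)
        moreover have "\<eta> < \<alpha>" using 1 less.prems by (meson less_trans)
        ultimately show ?thesis
          using less.IH[of \<eta>] 1 step[of \<eta>] rewrite_step_not_above[of U "ps \<eta>" "f \<eta>" "f \<gamma>" p]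
            not_above[of \<eta>] rewrite_step_rooted by metis
      next
        case 2
        \<comment> \<open>The levels counted by \<open>length p\<close> preserve the path to
          \<open>p\<close>, the additional one the symbol at \<open>p\<close>.\<close>
        obtain b where b: "b < \<gamma>" "\<And>x. b < x \<Longrightarrow> x < \<gamma> \<Longrightarrow> agree (length p + Suc 0) (f x) (f \<gamma>)"
          using continuous_on_agree[OF cont less_\<gamma> less.prems(2)] by blast
        define x where "x = max \<beta> (ord_succ b)"
        have x: "b < x" "x < \<gamma>" "\<beta> \<le> x"
          using b 2 less_\<gamma> ord_succ_gt[OF b(1)] by (auto simp: x_def less_max_iff_disj)
        then have "is_pos p (f x)" "rooted_in D (subterm_at p (f x))"
          using less.IH[of x] less.prems by auto
        then show ?thesis
          using b(2)[OF x(1,2)] is_pos_agree subterm_at_agree rooted_in_agree by blast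
      qed
    qed (use \<beta> in simp)
  qed
  define g where "g \<gamma> = top_layer D (subterm_at p (f \<gamma>))" for \<gamma>
  \<comment> \<open>Membership asks for a step of \<open>R\<close> and not for a change of
    \<open>g\<close>: a step may have equal source and target and must still count. Positions are
    taken relative to \<open>p\<close>, so a contraction at \<open>p\<close> becomes a root
    step.\<close>
  define A where "A = {\<gamma>. \<beta> \<le> \<gamma> \<and> \<gamma> < \<alpha> \<and> take (length p) (ps \<gamma>) = p \<and>
    rewrite_step R (drop (length p) (ps \<gamma>)) (g \<gamma>) (g (ord_succ \<gamma>))}"
  have step_p: "subterm_at p (f (ord_succ \<gamma>)) = subterm_at p (f \<gamma>) \<and> take (length p) (ps \<gamma>) \<noteq> p \<or>
      (\<exists>q. ps \<gamma> = p @ q \<and> rewrite_step U q (subterm_at p (f \<gamma>)) (subterm_at p (f (ord_succ \<gamma>))))"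
    if "\<beta> \<le> \<gamma>" "\<gamma> < \<alpha>" for \<gamma>
    using rewrite_step_not_above[OF step[OF that(2)]] inv[OF that] not_above[OF that] by blast
  have A_root: "\<gamma> \<in> A" if "\<beta> \<le> \<gamma>" "\<gamma> < \<alpha>" "ps \<gamma> = p" for \<gamma>
  proof -
    have "rewrite_step U [] (subterm_at p (f \<gamma>)) (subterm_at p (f (ord_succ \<gamma>)))"
      using step_p[OF that(1,2)] that(3) by auto
    then show ?thesis
      using rewrite_step_root inv[OF that(1,2)] that by (auto simp: A_def g_def)
  qed
  have "\<exists>\<gamma><\<alpha>. \<forall>\<eta>\<in>A. \<gamma> \<le> \<eta> \<longrightarrow> drop (length p) (ps \<eta>) \<noteq> []"
  proof (rule strongly_converging_stuttering[OF sc, of \<beta> \<alpha> g])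
    fix \<gamma> assume \<gamma>: "\<beta> \<le> \<gamma>" "\<gamma> < \<alpha>"
    have "f \<gamma> \<in> Ter (sig U)" using red \<gamma> by (auto simp: reduction_sequence_def)
    then show "g \<gamma> \<in> Ter (sig R)"
      unfolding g_def using inv[OF \<gamma>] by (intro top_layer_Ter[of _ "sig U"] subterm_at_Ter sig_U) auto
    show "g (ord_succ \<gamma>) = g \<gamma>" if "\<gamma> \<notin> A"
      using step_p[OF \<gamma>]
    proof (elim disjE exE conjE)
      fix q assume q: "ps \<gamma> = p @ q"
        "rewrite_step U q (subterm_at p (f \<gamma>)) (subterm_at p (f (ord_succ \<gamma>)))"
      then have "\<not> rewrite_step R q (g \<gamma>) (g (ord_succ \<gamma>))" using that \<gamma> by (auto simp: A_def)
      then show ?thesis using rewrite_step_top_layer[OF q(2)] by (simp add: g_def)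
    qed (simp add: g_def)
  next
    fix \<gamma> n assume \<gamma>: "\<beta> < \<gamma>" "\<gamma> < \<alpha>"
    obtain b where b: "b < \<gamma>" "\<And>x. b < x \<Longrightarrow> x < \<gamma> \<Longrightarrow> agree (length p + n) (f x) (f \<gamma>)"
      using continuous_on_agree[OF cont \<gamma>] by blast
    have "agree n (g x) (g \<gamma>)" if "b < x" "x < \<gamma>" "\<beta> \<le> x" for x
      unfolding g_def using b(2)[OF that(1,2)] inv[OF that(3)] that \<gamma>
      by (intro top_layer_agree subterm_at_agree) auto
    with b(1) show "\<exists>c<\<gamma>. \<forall>\<eta>. c < \<eta> \<and> \<eta> < \<gamma> \<and> \<beta> \<le> \<eta> \<longrightarrow> agree n (g \<eta>) (g \<gamma>)" by blast
  next
    fix \<gamma> assume \<gamma>: "\<gamma> < \<alpha>"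
    \<comment> \<open>Passing to \<open>ord_succ \<gamma>\<close> turns the weak bound given by
      \<open>cofinal\<close> into a strict one.\<close>
    have "max \<beta> (ord_succ \<gamma>) < \<alpha>" using \<beta> \<gamma> limit_ordinalD[OF \<alpha>] by simp
    then obtain \<eta> where "max \<beta> (ord_succ \<gamma>) \<le> \<eta>" "\<eta> < \<alpha>" "ps \<eta> = p" using cofinal by blast
    then show "\<exists>\<eta>\<in>A. \<gamma> < \<eta>"
      using A_root[of \<eta>] ord_succ_gt[OF \<gamma>] by (meson max.boundedE less_le_trans)
  qed (use \<beta> in \<open>auto simp: A_def\<close>)
  then obtain \<xi> where \<xi>: "\<xi> < \<alpha>" "\<And>\<eta>. \<eta> \<in> A \<Longrightarrow> \<xi> \<le> \<eta> \<Longrightarrow> drop (length p) (ps \<eta>) \<noteq> []" by blast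
  have "max \<beta> \<xi> < \<alpha>" using \<xi> \<beta> by simp
  then obtain \<eta> where "max \<beta> \<xi> \<le> \<eta>" "\<eta> < \<alpha>" "ps \<eta> = p" using cofinal by blast
  then show False using A_root[of \<eta>] \<xi>(2)[of \<eta>] by auto
qed

end

theorem theorem10p1:
  fixes R S :: "('f, 'v) itrs"
  assumes "wf_itrs R" and "wf_itrs S"
    and "dom (sig R) \<inter> dom (sig S) = {}"
    and "non_collapsing R" and "non_collapsing S"
    and "strongly_converging TYPE('o::{wellorder, linorder_topology}) R"
    and "strongly_converging TYPE('o) S"
  shows "strongly_converging TYPE('o) (disjoint_union R S)"
  unfolding strongly_converging_def
proof (intro allI impI, elim conjE)
  let ?U = "disjoint_union R S"
  interpret RS: disjoint_itrs R S using assms by unfold_locales auto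
  interpret SR: disjoint_itrs S R using assms by unfold_locales auto
  fix \<alpha> :: 'o and f :: "'o \<Rightarrow> ('f, 'v) iterm" and ps :: "'o \<Rightarrow> pos" and p :: pos
  assume \<alpha>: "limit_ordinal \<alpha>" and red: "reduction_sequence ?U \<alpha> f ps"
  show "\<exists>\<beta><\<alpha>. \<forall>\<gamma>. \<beta> \<le> \<gamma> \<and> \<gamma> < \<alpha> \<longrightarrow> ps \<gamma> \<noteq> p"
  \<comment> \<open>Induction on length replaces the choice of a shortest offending position: proper
    prefixes of \<open>p\<close> are already settled.\<close>
  proof (induction p rule: length_induct)
    case (1 p)
    \<comment> \<open>The finitely many proper prefixes of \<open>p\<close> have a common bound, a
      maximum of the individual ones.\<close>
    have "\<exists>\<beta><\<alpha>. \<forall>\<gamma>. \<beta> \<le> \<gamma> \<and> \<gamma> < \<alpha> \<longrightarrow> (\<forall>k<n. ps \<gamma> \<noteq> take k p)" if "n \<le> length p" for n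
      using that
    proof (induction n)
      case 0
      then show ?case using \<alpha> by (auto simp: limit_ordinal_def)
    next
      case (Suc n)
      then obtain \<beta> where \<beta>: "\<beta> < \<alpha>" "\<And>\<gamma> k. \<beta> \<le> \<gamma> \<Longrightarrow> \<gamma> < \<alpha> \<Longrightarrow> k < n \<Longrightarrow> ps \<gamma> \<noteq> take k p"
        by fastforce
      from Suc.prems 1 obtain \<beta>' where \<beta>': "\<beta>' < \<alpha>" "\<And>\<gamma>. \<beta>' \<le> \<gamma> \<Longrightarrow> \<gamma> < \<alpha> \<Longrightarrow> ps \<gamma> \<noteq> take n p"
        by (metis Suc_le_eq length_take min.absorb4)
      show ?case using \<beta> \<beta>' by (intro exI[of _ "max \<beta> \<beta>'"]) (auto simp: less_Suc_eq)
    qed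
    then obtain \<beta> where \<beta>: "\<beta> < \<alpha>"
      "\<And>\<gamma> k. \<beta> \<le> \<gamma> \<Longrightarrow> \<gamma> < \<alpha> \<Longrightarrow> k < length p \<Longrightarrow> ps \<gamma> \<noteq> take k p" by blast
    show ?case
    \<comment> \<open>If \<open>p\<close> does not occur from \<open>\<beta>\<close> on,
      \<open>\<beta>\<close> is the bound. Otherwise the redex contracted at \<open>p\<close> at
      some stage \<open>\<gamma>\<close> decides whose signature holds the root, and the argument
      starts at \<open>\<gamma>\<close>.\<close>
    proof (cases "\<exists>\<gamma>. \<beta> \<le> \<gamma> \<and> \<gamma> < \<alpha> \<and> ps \<gamma> = p")
      case True
      then obtain \<gamma> where \<gamma>: "\<beta> \<le> \<gamma>" "\<gamma> < \<alpha>" "ps \<gamma> = p" by blast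
      then have "rewrite_step ?U p (f \<gamma>) (f (ord_succ \<gamma>))"
        using red limit_ordinalD[OF \<alpha>] by (auto simp: reduction_sequence_def)
      then obtain l r \<theta> where lr: "(l, r) \<in> rules ?U" "is_pos p (f \<gamma>)" "subterm_at p (f \<gamma>) = subst \<theta> l"
        by (auto simp: rewrite_step_def)
      have not_above: "ps \<eta> \<noteq> take k p" if "\<gamma> \<le> \<eta>" "\<eta> < \<alpha>" "k < length p" for \<eta> k
        using \<beta>(2)[of \<eta> k] that \<gamma>(1) by simp
      from lr(1) consider "(l, r) \<in> rules R" | "(l, r) \<in> rules S" by (auto simp: disjoint_union_def)
      then show ?thesis
      proof cases
        case 1
        then have "rooted_in (dom (sig R)) (subst \<theta> l)"
          using assms(1) rooted_in_Ter rooted_in_subst by (fastforce simp: wf_itrs_def)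
        then show ?thesis
          using RS.not_cofinal_if_rooted[OF assms(6) \<alpha> red \<gamma>(2) lr(2)] lr(3) not_above by simp
      next
        case 2
        then have "rooted_in (dom (sig S)) (subst \<theta> l)"
          using assms(2) rooted_in_Ter rooted_in_subst by (fastforce simp: wf_itrs_def)
        \<comment> \<open>The instance \<open>SR\<close> concerns the union in the opposite order,
          which is the same system because the signatures are disjoint.\<close>
        moreover have "reduction_sequence (disjoint_union S R) \<alpha> f ps"
          using red disjoint_union_commute[OF assms(3)] by simp
        ultimately show ?thesis
          using SR.not_cofinal_if_rooted[OF assms(7) \<alpha> _ \<gamma>(2), of f ps p] lr(2,3) not_above by simp
      qed
    qed (use \<beta> in blast)
  qed
qed

end
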